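(* Let $\mathbb{K}$ be a field of characteristic zero, let $A\in\mathbb{K}^{n\times n}$, and suppose that the irreducible factorization $\chi_A(\lambda)=f_1(\lambda)^{m_1}\cdots f_q(\lambda)^{m_q}$ of its characteristic polynomial is given. When the vectors $\bm{u}g_1(A),\ldots,\bm{u}g_q(A)$ are calculated by binary splitting, Algorithm P (described in the context) calculates the unit pseudo annihilating polynomials $\pi'_{A,j}(\lambda)$, $j=1,\ldots,n$, with $$O(n^3\max\{1,\log_2 q\})$$ arithmetic operations in $\mathbb{K}$.
   Context: Setting. $f_1,\ldots,f_q$ are the pairwise distinct monic irreducible factors of $\chi_A$ over $\mathbb{K}$, $m_p\ge1$, $F_p=f_p(A)$, $g_p(\lambda)=\chi_A(\lambda)/f_p(\lambda)^{m_p}$. Cost model. Time is counted in arithmetic operations in $\mathbb{K}$; the factorization of $\chi_A$ is assumed given. A product $\bm{w}f(A)$ of a row vector with $f(A)$, $\deg f=d$, is computed by Horner's rule with vector-matrix products, at cost $O(n^2d)$. Pseudo annihilating polynomials. For a nonzero row vector $\bm{u}\in\mathbb{K}^n$ let $w_{i,j}^{(k)}$ be the $j$-th entry of $\bm{u}g_i(A)F_i^k$ ($k\ge0$) and let $\rho_{i,j}$ be the smallest $k\ge0$ with $w_{i,j}^{(k)}=0$. The $j$-th unit pseudo annihilating polynomial (with respect to $\bm{u}$) is $\pi'_{A,j}=\prod_{i=1}^q f_i^{\rho_{i,j}}$. Algorithm P. Generate a random row vector $\bm{u}$. For $i=1,\ldots,q$: compute $\bar{\bm{b}}=\bm{u}g_i(A)$;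 then for $k=0,1,\ldots,m_i-1$, for every $j$ whose exponent $\rho_{i,j}$ has not yet been set and for which the $j$-th entry of $\bar{\bm{b}}$ is $0$, set $\rho_{i,j}=k$, and then replace $\bar{\bm{b}}$ by $\bar{\bm{b}}f_i(A)$ (this loop is left as soon as, at the start of a pass, $\bar{\bm{b}}=\bm{0}$ and all $\rho_{i,j}$, $1\le j\le n$, are set); finally set every still unset $\rho_{i,j}$ to $m_i$. Output $(\rho_{i,j})$. Binary splitting. The binary tree has nodes of the form $S(p',p'')=\{p',p'+1,\ldots,p''\}$, with root $S=S(1,q)=\{1,\ldots,q\}$; a node $S(p',p'')$ with $p'<p''$ has children $S(p',p'+\lfloor(p''-p')/2\rfloor)$ and $S(p'+\lfloor(p''-p')/2\rfloor+1,p'')$; a node with $p'=p''$ is a leaf. For a node $I$ put $\bm{v}_I=\bm{u}\prod_{j\in S\setminus I}F_j^{m_j}$. Starting from $\bm{v}_S=\bm{u}$, for each child $J$ of $I$ one computes $\bm{v}_J=\bm{v}_I\prod_{j\in I\setminus J}F_j^{m_j}$; the leaves give $\bm{v}_{\{p\}}=\bm{u}g_p(A)$. *)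

theory Defs
  imports "HOL-Library.State_Monad" "Jordan_Normal_Form.Char_Poly"
begin

subsection \<open>Row vectors, matrix polynomials and pseudo annihilating polynomials\<close>

text \<open>Vectors of type \<^typ>\<open>'a vec\<close> carry no orientation; \<open>row_mult u A\<close> reads \<open>u\<close> as a row vector.\<close>

definition row_mult :: "'a::semiring_0 vec \<Rightarrow> 'a mat \<Rightarrow> 'a vec" where
  "row_mult u A = vec (dim_col A) (\<lambda>j. u \<bullet> col A j)"

definition poly_mat :: "'a::comm_ring_1 poly \<Rightarrow> 'a mat \<Rightarrow> 'a mat" where
  "poly_mat f A = mat (dim_row A) (dim_row A)
     (\<lambda>(r, s). \<Sum>i\<le>degree f. coeff f i * (A ^\<^sub>m i) $$ (r, s))"

definition irreducible_factorization ::
    "'a::field poly \<Rightarrow> nat \<Rightarrow> (nat \<Rightarrow> 'a poly) \<Rightarrow> (nat \<Rightarrow> nat) \<Rightarrow> bool" where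
  "irreducible_factorization h q f m \<longleftrightarrow>
     (\<forall>p\<in>{1..q}. monic (f p) \<and> irreducible (f p) \<and> 1 \<le> m p) \<and>
     inj_on f {1..q} \<and> h = (\<Prod>p=1..q. f p ^ m p)"

definition cofactor_poly ::
    "'a::field mat \<Rightarrow> (nat \<Rightarrow> 'a poly) \<Rightarrow> (nat \<Rightarrow> nat) \<Rightarrow> nat \<Rightarrow> 'a poly" where
  "cofactor_poly A f m p = char_poly A div f p ^ m p"

text \<open>Factors are indexed by \<open>1, \<dots>, q\<close>; vector entries are indexed by \<open>0, \<dots>, n - 1\<close>,
  as everywhere for \<^typ>\<open>'a vec\<close>.\<close>

definition w_entry ::
    "'a::field mat \<Rightarrow> (nat \<Rightarrow> 'a poly) \<Rightarrow> (nat \<Rightarrow> nat) \<Rightarrow> 'a vec \<Rightarrow> nat \<Rightarrow> nat \<Rightarrow> nat \<Rightarrow> 'a" where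
  "w_entry A f m u i j k =
     row_mult (row_mult u (poly_mat (cofactor_poly A f m i) A)) (poly_mat (f i) A ^\<^sub>m k) $ j"

text \<open>The minimum exists by the Cayley-Hamilton theorem: \<open>k = m i\<close> always qualifies.\<close>

definition pa_exponent ::
    "'a::field mat \<Rightarrow> (nat \<Rightarrow> 'a poly) \<Rightarrow> (nat \<Rightarrow> nat) \<Rightarrow> 'a vec \<Rightarrow> nat \<Rightarrow> nat \<Rightarrow> nat" where
  "pa_exponent A f m u i j = (LEAST k. w_entry A f m u i j k = 0)"

definition unit_pseudo_annihilating_poly ::
    "'a::field mat \<Rightarrow> nat \<Rightarrow> (nat \<Rightarrow> 'a poly) \<Rightarrow> (nat \<Rightarrow> nat) \<Rightarrow> 'a vec \<Rightarrow> nat \<Rightarrow> 'a poly" where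
  "unit_pseudo_annihilating_poly A q f m u j = (\<Prod>i=1..q. f i ^ pa_exponent A f m u i j)"

subsection \<open>Counting arithmetic operations\<close>

text \<open>The state is the number of field operations performed so far. Only \<open>add\<close> and \<open>mult\<close>
  advance it, and the algorithms below obtain new field elements only through these two.
  Zero tests and index bookkeeping are not arithmetic operations and are free.\<close>

type_synonym 'b counted = "(nat, 'b) state"

definition tick :: "unit counted" where
  "tick = State (\<lambda>t. ((), Suc t))"

definition add :: "'a::plus \<Rightarrow> 'a \<Rightarrow> 'a counted" where
  "add x y = do { tick; State_Monad.return (x + y) }"

definition mult :: "'a::times \<Rightarrow> 'a \<Rightarrow> 'a counted" where
  "mult x y = do { tick; State_Monad.return (x * y) }"

definition result :: "'b counted \<Rightarrow> 'b" where
  "result c = fst (run_state c 0)"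

definition operations :: "'b counted \<Rightarrow> nat" where
  "operations c = snd (run_state c 0)"

subsection \<open>Vector operations and Horner's rule\<close>

fun dot_counted :: "('a::semiring_0 \<times> 'a) list \<Rightarrow> 'a counted" where
  "dot_counted [] = State_Monad.return 0"
| "dot_counted ((x, y) # ps) = do {
     s \<leftarrow> dot_counted ps;
     t \<leftarrow> mult x y;
     add t s }"

definition row_mult_counted :: "'a::semiring_0 vec \<Rightarrow> 'a mat \<Rightarrow> 'a vec counted" where
  "row_mult_counted w A = do {
     xs \<leftarrow> traverse_list (\<lambda>j. dot_counted (zip (list_of_vec w) (list_of_vec (col A j)))) [0..<dim_col A];
     State_Monad.return (vec_of_list xs) }"

definition smult_counted :: "'a::semiring_0 \<Rightarrow> 'a vec \<Rightarrow> 'a vec counted" where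
  "smult_counted c w = do {
     xs \<leftarrow> traverse_list (mult c) (list_of_vec w);
     State_Monad.return (vec_of_list xs) }"

definition add_counted :: "'a::semiring_0 vec \<Rightarrow> 'a vec \<Rightarrow> 'a vec counted" where
  "add_counted v w = do {
     xs \<leftarrow> traverse_list (\<lambda>(x, y). add x y) (zip (list_of_vec v) (list_of_vec w));
     State_Monad.return (vec_of_list xs) }"

text \<open>The coefficient list starts with the constant term.\<close>

fun horner_coeffs :: "'a::semiring_0 mat \<Rightarrow> 'a vec \<Rightarrow> 'a list \<Rightarrow> 'a vec counted" where
  "horner_coeffs A w [] = State_Monad.return (0\<^sub>v (dim_vec w))"
| "horner_coeffs A w [c] = smult_counted c w"
| "horner_coeffs A w (c # c' # cs) = do {
     b \<leftarrow> horner_coeffs A w (c' # cs);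
     bA \<leftarrow> row_mult_counted b A;
     cw \<leftarrow> smult_counted c w;
     add_counted bA cw }"

definition horner :: "'a::semiring_0 mat \<Rightarrow> 'a vec \<Rightarrow> 'a poly \<Rightarrow> 'a vec counted" where
  "horner A w f = horner_coeffs A w (coeffs f)"

subsection \<open>Binary splitting\<close>

fun mult_power :: "'a::semiring_0 mat \<Rightarrow> 'a poly \<Rightarrow> nat \<Rightarrow> 'a vec \<Rightarrow> 'a vec counted" where
  "mult_power A f 0 v = State_Monad.return v"
| "mult_power A f (Suc k) v = do {
     v' \<leftarrow> horner A v f;
     mult_power A f k v' }"

fun mult_factors ::
    "'a::semiring_0 mat \<Rightarrow> (nat \<Rightarrow> 'a poly) \<Rightarrow> (nat \<Rightarrow> nat) \<Rightarrow> nat list \<Rightarrow> 'a vec \<Rightarrow> 'a vec counted" where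
  "mult_factors A f m [] v = State_Monad.return v"
| "mult_factors A f m (p # ps) v = do {
     v' \<leftarrow> mult_power A (f p) (m p) v;
     mult_factors A f m ps v' }"

text \<open>At the node \<open>I = {p'..p''}\<close> with vector \<open>v\<close>, the vector of either child \<open>J\<close> is obtained from
  \<open>v\<close> by applying the factors with index in \<open>I - J\<close>, the other child. The result lists the
  leaf vectors in the order \<open>p', \<dots>, p''\<close>.\<close>

function binary_splitting ::
    "'a::semiring_0 mat \<Rightarrow> (nat \<Rightarrow> 'a poly) \<Rightarrow> (nat \<Rightarrow> nat) \<Rightarrow> nat \<Rightarrow> nat \<Rightarrow> 'a vec \<Rightarrow> 'a vec list counted" where
  "binary_splitting A f m p' p'' v =
     (if p'' \<le> p' then State_Monad.return [v]
      else do {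
        let h = p' + (p'' - p') div 2;
        vl \<leftarrow> mult_factors A f m [Suc h..<Suc p''] v;
        vr \<leftarrow> mult_factors A f m [p'..<Suc h] v;
        ls \<leftarrow> binary_splitting A f m p' h vl;
        rs \<leftarrow> binary_splitting A f m (Suc h) p'' vr;
        State_Monad.return (ls @ rs) })"
  by auto
termination
  by (relation "measure (\<lambda>(A, f, m, p', p'', v). p'' - p')") auto

declare binary_splitting.simps [simp del]

subsection \<open>The algorithm\<close>

text \<open>\<open>None\<close> marks an exponent that has not been set yet. The list argument of
  \<open>exponent_loop\<close> holds the remaining values of the loop counter.\<close>

definition set_exponents :: "nat \<Rightarrow> 'a::zero vec \<Rightarrow> nat option list \<Rightarrow> nat option list" where
  "set_exponents k b r =
     map2 (\<lambda>x e. if e = None \<and> x = 0 then Some k else e) (list_of_vec b) r"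

fun exponent_loop ::
    "'a::semiring_0 mat \<Rightarrow> 'a poly \<Rightarrow> nat list \<Rightarrow> 'a vec \<Rightarrow> nat option list \<Rightarrow> nat option list counted" where
  "exponent_loop A f [] b r = State_Monad.return r"
| "exponent_loop A f (k # ks) b r =
     (if b = 0\<^sub>v (dim_vec b) \<and> None \<notin> set r then State_Monad.return r
      else do {
        let r' = set_exponents k b r;
        b' \<leftarrow> horner A b f;
        exponent_loop A f ks b' r' })"

definition exponents :: "'a::semiring_0 mat \<Rightarrow> 'a poly \<Rightarrow> nat \<Rightarrow> 'a vec \<Rightarrow> nat list counted" where
  "exponents A f m b = do {
     r \<leftarrow> exponent_loop A f [0..<m] b (replicate (dim_vec b) None);
     State_Monad.return (map (\<lambda>e. case e of None \<Rightarrow> m | Some k \<Rightarrow> k) r) }"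

text \<open>The random row vector is the argument \<open>u\<close>. Row \<open>i - 1\<close> of the output table belongs to the
  factor \<open>f i\<close>, column \<open>j\<close> to the vector entry \<open>j\<close>.\<close>

definition algorithm_P ::
    "'a::semiring_0 mat \<Rightarrow> nat \<Rightarrow> (nat \<Rightarrow> 'a poly) \<Rightarrow> (nat \<Rightarrow> nat) \<Rightarrow> 'a vec \<Rightarrow> nat list list counted" where
  "algorithm_P A q f m u = do {
     bs \<leftarrow> binary_splitting A f m 1 q u;
     traverse_list (\<lambda>i. exponents A (f i) (m i) (bs ! (i - 1))) [1..<Suc q] }"

end

theory Submission
  imports Defs
begin

text \<open>A Horner evaluation of \<open>w f(A)\<close> costs at most \<open>5 n\<^sup>2 deg f\<close> operations, as \<open>deg f \<ge> 1\<close>. Applying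
  every \<open>f p\<close> exactly \<open>m p\<close> times therefore costs at most \<open>5 n\<^sup>3\<close>, because
  \<open>\<Sum> m p deg (f p) = deg \<chi>\<^sub>A = n\<close>. Binary splitting does this at most once on each of its at most
  \<open>\<lceil>log\<^sub>2 q\<rceil>\<close> levels, and the exponent loops do it at most once more. The exponents are correct since
  \<open>u g\<^sub>i(A) f\<^sub>i(A)\<^bsup>m i\<^esup> = u \<chi>\<^sub>A(A) = 0\<close> by Cayley-Hamilton, so that \<open>m i\<close> is the right default.\<close>

subsection \<open>Polynomials in a matrix acting on row vectors\<close>

lemma row_mult_carrier: "B \<in> carrier_mat n n \<Longrightarrow> row_mult u B \<in> carrier_vec n"
  by (simp add: row_mult_def carrier_vecI)

text \<open>Reduces the row action to the column action of the transpose, whose associativity is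
  already known.\<close>

lemma row_mult_transpose:
  fixes B :: "'a::comm_semiring_0 mat"
  assumes "B \<in> carrier_mat n n" "u \<in> carrier_vec n"
  shows "row_mult u B = transpose_mat B *\<^sub>v u"
  using assms by (intro eq_vecI) (auto simp: row_mult_def intro: comm_scalar_prod)

lemma row_mult_mult:
  fixes B C :: "'a::comm_semiring_0 mat"
  assumes "u \<in> carrier_vec n" "B \<in> carrier_mat n n" "C \<in> carrier_mat n n"
  shows "row_mult (row_mult u B) C = row_mult u (B * C)"
proof -
  have "row_mult (row_mult u B) C = transpose_mat C *\<^sub>v (transpose_mat B *\<^sub>v u)"
    using assms row_mult_carrier[of B n u] by (simp add: row_mult_transpose)
  also have "\<dots> = transpose_mat (B * C) *\<^sub>v u"
    using assms by (simp add: transpose_mult[of B n n C n])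
  finally show ?thesis
    using assms by (simp add: row_mult_transpose[OF mult_carrier_mat[of B n n C n]])
qed

lemma row_mult_add_mat:
  fixes B C :: "'a::comm_semiring_0 mat"
  assumes "u \<in> carrier_vec n" "B \<in> carrier_mat n n" "C \<in> carrier_mat n n"
  shows "row_mult u (B + C) = row_mult u B + row_mult u C"
  using assms
  by (intro eq_vecI) (auto simp: row_mult_def col_add intro: scalar_prod_add_distrib[of _ n])

lemma row_mult_smult_one:
  fixes c :: "'a::comm_semiring_1"
  assumes "u \<in> carrier_vec n"
  shows "row_mult u (c \<cdot>\<^sub>m 1\<^sub>m n) = c \<cdot>\<^sub>v u"
  using assms by (intro eq_vecI) (auto simp: row_mult_def)

section \<open>Evaluating polynomials at \<open>A\<close> respects sums, products and powers\<close>

context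
  fixes A :: "'a::comm_ring_1 mat" and n :: nat
  assumes A: "A \<in> carrier_mat n n"
begin

lemma poly_mat_carrier [simp]: "poly_mat f A \<in> carrier_mat n n"
  using A by (simp add: poly_mat_def)

lemma poly_mat_dim [simp]: "dim_row (poly_mat f A) = n" "dim_col (poly_mat f A) = n"
  using poly_mat_carrier by blast+

text \<open>The free bound \<open>N\<close> lets polynomials of different degrees be compared over
  one common range of summation.\<close>

lemma index_poly_mat:
  assumes "r < n" "s < n" "degree f \<le> N"
  shows "poly_mat f A $$ (r, s) = (\<Sum>i\<le>N. coeff f i * (A ^\<^sub>m i) $$ (r, s))"
proof -
  have "(\<Sum>i\<le>degree f. coeff f i * (A ^\<^sub>m i) $$ (r, s)) = (\<Sum>i\<le>N. coeff f i * (A ^\<^sub>m i) $$ (r, s))"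
    using assms by (intro sum.mono_neutral_left) (auto simp: coeff_eq_0)
  then show ?thesis
    using assms A by (simp add: poly_mat_def)
qed

lemma poly_mat_0: "poly_mat 0 A = 0\<^sub>m n n"
  by (intro eq_matI) (auto simp: index_poly_mat[where N = 0])

lemma poly_mat_1: "poly_mat 1 A = 1\<^sub>m n"
  using A by (intro eq_matI) (auto simp: index_poly_mat[where N = 0])

lemma poly_mat_add: "poly_mat (f + g) A = poly_mat f A + poly_mat g A"
proof (intro eq_matI)
  fix r s assume "r < dim_row (poly_mat f A + poly_mat g A)" "s < dim_col (poly_mat f A + poly_mat g A)"
  then have rs: "r < n" "s < n" by auto
  let ?N = "max (degree f) (degree g)"
  show "poly_mat (f + g) A $$ (r, s) = (poly_mat f A + poly_mat g A) $$ (r, s)"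
    using rs
    by (simp add: index_poly_mat[where N = ?N] degree_add_le_max sum.distrib distrib_right)
qed auto

lemma poly_mat_smult: "poly_mat (Polynomial.smult c f) A = c \<cdot>\<^sub>m poly_mat f A"
  by (intro eq_matI)
    (auto simp: index_poly_mat[where N = "degree f"] degree_smult_le sum_distrib_left mult.assoc)

text \<open>The recursion behind Horner's rule, with the new factor \<open>A\<close> on the right,
  where a row vector meets it last. Inductions over polynomials below rest on it.\<close>

lemma poly_mat_pCons: "poly_mat (pCons c f) A = c \<cdot>\<^sub>m 1\<^sub>m n + poly_mat f A * A"
proof (intro eq_matI)
  fix r s assume "r < dim_row (c \<cdot>\<^sub>m 1\<^sub>m n + poly_mat f A * A)"
    "s < dim_col (c \<cdot>\<^sub>m 1\<^sub>m n + poly_mat f A * A)"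
  then have rs: "r < n" "s < n" using A by auto
  have pow: "(A ^\<^sub>m Suc i) $$ (r, s) = (\<Sum>k<n. (A ^\<^sub>m i) $$ (r, k) * A $$ (k, s))" for i
    using rs A by (simp add: scalar_prod_def lessThan_atLeast0)
  have "poly_mat (pCons c f) A $$ (r, s) =
      (\<Sum>i\<le>Suc (degree f). coeff (pCons c f) i * (A ^\<^sub>m i) $$ (r, s))"
    using rs by (intro index_poly_mat) (auto simp: degree_pCons_le)
  also have "\<dots> = c * 1\<^sub>m n $$ (r, s) + (\<Sum>i\<le>degree f. coeff f i * (A ^\<^sub>m Suc i) $$ (r, s))"
    using A by (subst sum.atMost_Suc_shift) simp
  also have "(\<Sum>i\<le>degree f. coeff f i * (A ^\<^sub>m Suc i) $$ (r, s)) =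
      (\<Sum>k<n. \<Sum>i\<le>degree f. coeff f i * (A ^\<^sub>m i) $$ (r, k) * A $$ (k, s))"
    unfolding pow sum_distrib_left mult.assoc[symmetric] by (rule sum.swap)
  also have "\<dots> = (\<Sum>k<n. poly_mat f A $$ (r, k) * A $$ (k, s))"
    using rs by (simp add: index_poly_mat[where N = "degree f"] sum_distrib_right)
  also have "\<dots> = (poly_mat f A * A) $$ (r, s)"
    using rs A by (simp add: scalar_prod_def lessThan_atLeast0)
  finally show "poly_mat (pCons c f) A $$ (r, s) = (c \<cdot>\<^sub>m 1\<^sub>m n + poly_mat f A * A) $$ (r, s)"
    using rs A by simp
qed (use A in auto)

text \<open>\<open>poly_mat_pCons\<close> always produces \<open>A\<close> on the right, so
  multiplicativity requires moving it past another polynomial in \<open>A\<close>.\<close>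

lemma poly_mat_commute: "A * poly_mat f A = poly_mat f A * A"
proof (induction f)
  case 0
  then show ?case using A by (simp add: poly_mat_0)
next
  case (pCons c f)
  have P: "poly_mat f A * A \<in> carrier_mat n n" using A by (intro mult_carrier_mat) auto
  have "A * poly_mat (pCons c f) A = A * (c \<cdot>\<^sub>m 1\<^sub>m n) + A * (poly_mat f A * A)"
    unfolding poly_mat_pCons by (intro mult_add_distrib_mat[OF A]) (auto intro: P)
  also have "A * (poly_mat f A * A) = (A * poly_mat f A) * A"
    using A by (simp add: assoc_mult_mat[OF A poly_mat_carrier A])
  also have "\<dots> = (poly_mat f A * A) * A"
    using pCons.IH by simp
  also have "A * (c \<cdot>\<^sub>m 1\<^sub>m n) = (c \<cdot>\<^sub>m 1\<^sub>m n) * A"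
    using A by (simp add: mult_smult_distrib[OF A one_carrier_mat] mult_smult_assoc_mat[OF one_carrier_mat A])
  also have "(c \<cdot>\<^sub>m 1\<^sub>m n) * A + (poly_mat f A * A) * A = poly_mat (pCons c f) A * A"
    unfolding poly_mat_pCons by (intro add_mult_distrib_mat[symmetric, OF _ P A]) auto
  finally show ?case .
qed

lemma poly_mat_mult: "poly_mat (f * g) A = poly_mat f A * poly_mat g A"
proof (induction f)
  case 0
  then show ?case by (simp add: poly_mat_0 left_mult_zero_mat[OF poly_mat_carrier])
next
  case (pCons c f)
  have P: "poly_mat f A * A \<in> carrier_mat n n" using A by (intro mult_carrier_mat) auto
  have FG: "(poly_mat f A * poly_mat g A) * A \<in> carrier_mat n n"
    using A by (intro mult_carrier_mat) auto
  \<comment> \<open>The product \<open>pCons c f * g\<close> unfolds to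
    \<open>smult c g + pCons 0 (f * g)\<close>; its constant coefficient 0 leaves a zero matrix to
    be dropped.\<close>
  have "((0::'a) \<cdot>\<^sub>m 1\<^sub>m n) + (poly_mat f A * poly_mat g A) * A = (poly_mat f A * poly_mat g A) * A"
    using FG by (intro eq_matI) auto
  then have "poly_mat (pCons c f * g) A = c \<cdot>\<^sub>m poly_mat g A + (poly_mat f A * poly_mat g A) * A"
    using pCons.IH by (simp add: poly_mat_add poly_mat_smult poly_mat_pCons)
  also have "(poly_mat f A * poly_mat g A) * A = (poly_mat f A * A) * poly_mat g A"
    using A by (simp add: assoc_mult_mat[of _ n n _ n _ n] poly_mat_commute)
  also have "c \<cdot>\<^sub>m poly_mat g A = (c \<cdot>\<^sub>m 1\<^sub>m n) * poly_mat g A"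
    by (simp add: mult_smult_assoc_mat[OF one_carrier_mat poly_mat_carrier]
        left_mult_one_mat[OF poly_mat_carrier])
  also have "(c \<cdot>\<^sub>m 1\<^sub>m n) * poly_mat g A + (poly_mat f A * A) * poly_mat g A =
      poly_mat (pCons c f) A * poly_mat g A"
    unfolding poly_mat_pCons by (intro add_mult_distrib_mat[symmetric, OF _ P]) auto
  finally show ?case .
qed

lemma poly_mat_power: "poly_mat (f ^ k) A = poly_mat f A ^\<^sub>m k"
proof (induction k)
  case (Suc k)
  have "poly_mat (f ^ Suc k) A = poly_mat (f ^ k * f) A"
    by (simp add: mult.commute)
  then show ?case by (simp only: poly_mat_mult Suc.IH pow_mat.simps)
qed (simp add: poly_mat_1)

lemma index_poly_mat_sum:
  assumes "r < n" "s < n"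
  shows "poly_mat (sum g S) A $$ (r, s) = (\<Sum>x\<in>S. poly_mat (g x) A $$ (r, s))"
  using assms by (induction S rule: infinite_finite_induct) (simp_all add: poly_mat_0 poly_mat_add)

text \<open>With \<open>\<lambda>\<close> acting on row vectors as right multiplication by \<open>A\<close>, the characteristic matrix
  kills the column \<open>(e\<^sub>0, \<dots>, e\<^sub>n\<^sub>-\<^sub>1)\<close> of unit vectors; multiplying by its adjugate from the left shows
  that \<open>\<chi>\<^sub>A\<close> kills every \<open>e\<^sub>k\<close>.\<close>

lemma cayley_hamilton: "poly_mat (char_poly A) A = 0\<^sub>m n n"
proof (rule eq_matI)
  fix i s assume "i < dim_row (0\<^sub>m n n :: 'a mat)" "s < dim_col (0\<^sub>m n n :: 'a mat)"
  then have i: "i < n" and s: "s < n" by auto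
  define M where "M = char_poly_matrix A"
  have M: "M \<in> carrier_mat n n" using A by (simp add: M_def)
  have B: "adj_mat M \<in> carrier_mat n n" "adj_mat M * M = char_poly A \<cdot>\<^sub>m 1\<^sub>m n"
    using adj_mat[OF M] by (simp_all add: char_poly_def M_def)
  define B' where "B' j = adj_mat M $$ (i, j)" for j
  \<comment> \<open>Row \<open>j\<close> of the characteristic matrix sends the column of unit
    vectors to e_j A minus the sum of the A_jk e_k, which is zero; this is its coordinate
    \<open>t\<close>.\<close>
  have kill: "(\<Sum>k<n. poly_mat (M $$ (j, k)) A $$ (k, t)) = 0" if j: "j < n" and t: "t < n" for j t
  proof -
    have "poly_mat (M $$ (j, k)) A $$ (k, t) =
        (if k = j then A $$ (j, t) else 0) - (if k = t then A $$ (j, t) else 0)" if k: "k < n" for k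
    proof -
      have "M $$ (j, k) = (if k = j then [:- A $$ (j, k), 1:] else [:- A $$ (j, k):])"
        using j k A by (auto simp: M_def char_poly_matrix_def)
      then show ?thesis
        using j k t A by (auto simp: poly_mat_pCons poly_mat_0)
    qed
    then show ?thesis
      using j t by (simp add: sum_subtractf sum.delta)
  qed
  \<comment> \<open>Writing the entry as row \<open>i\<close> of the diagonal matrix
    \<open>char_poly A \<cdot>\<^sub>m 1\<^sub>m n\<close> applied to the unit vectors makes room
    for \<open>adj_mat M * M\<close>.\<close>
  have "poly_mat (char_poly A) A $$ (i, s) =
      (\<Sum>k<n. poly_mat (if k = i then char_poly A else 0) A $$ (k, s))"
    using i s by (subst sum.remove[of _ i]) (auto simp: poly_mat_0 intro!: sum.neutral)
  also have "\<dots> = (\<Sum>k<n. poly_mat (\<Sum>j<n. M $$ (j, k) * B' j) A $$ (k, s))"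
  proof (intro sum.cong refl)
    fix k assume "k \<in> {..<n}"
    then have k: "k < n" by simp
    have "(if k = i then char_poly A else 0) = (adj_mat M * M) $$ (i, k)"
      using i k by (auto simp: B)
    \<comment> \<open>The polynomial factors are exchanged so that the entry of \<open>M\<close> is
      evaluated on the left, where \<open>kill\<close> can absorb the sum over
      \<open>k\<close>.\<close>
    also have "\<dots> = (\<Sum>j<n. M $$ (j, k) * B' j)"
      using i k B(1) M by (simp add: scalar_prod_def B'_def lessThan_atLeast0 mult.commute)
    finally show "poly_mat (if k = i then char_poly A else 0) A $$ (k, s) =
        poly_mat (\<Sum>j<n. M $$ (j, k) * B' j) A $$ (k, s)" by simp
  qed
  also have "\<dots> = (\<Sum>k<n. \<Sum>j<n. \<Sum>t<n. poly_mat (M $$ (j, k)) A $$ (k, t) * poly_mat (B' j) A $$ (t, s))"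
    using s by (simp add: index_poly_mat_sum poly_mat_mult scalar_prod_def lessThan_atLeast0)
  also have "\<dots> = (\<Sum>j<n. \<Sum>k<n. \<Sum>t<n. poly_mat (M $$ (j, k)) A $$ (k, t) * poly_mat (B' j) A $$ (t, s))"
    by (rule sum.swap)
  also have "\<dots> = (\<Sum>j<n. \<Sum>t<n. (\<Sum>k<n. poly_mat (M $$ (j, k)) A $$ (k, t)) * poly_mat (B' j) A $$ (t, s))"
    unfolding sum_distrib_right by (intro sum.cong refl sum.swap)
  also have "\<dots> = 0" by (simp add: kill)
  finally show "poly_mat (char_poly A) A $$ (i, s) = 0\<^sub>m n n $$ (i, s)" using i s by simp
qed auto

section \<open>The action of polynomials in \<open>A\<close> on row vectors\<close>

lemma row_mult_poly_mat_mult: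
  assumes "u \<in> carrier_vec n"
  shows "row_mult (row_mult u (poly_mat f A)) (poly_mat g A) = row_mult u (poly_mat (f * g) A)"
  using assms by (simp add: row_mult_mult poly_mat_mult)

lemma row_mult_poly_mat_pCons:
  assumes "u \<in> carrier_vec n"
  shows "row_mult u (poly_mat (pCons c f) A) = row_mult (row_mult u (poly_mat f A)) A + c \<cdot>\<^sub>v u"
proof -
  have P: "poly_mat f A * A \<in> carrier_mat n n" using A by (intro mult_carrier_mat) auto
  have "row_mult u (poly_mat (pCons c f) A) = c \<cdot>\<^sub>v u + row_mult u (poly_mat f A * A)"
    unfolding poly_mat_pCons using assms P by (simp add: row_mult_add_mat row_mult_smult_one)
  also have "\<dots> = row_mult (row_mult u (poly_mat f A)) A + c \<cdot>\<^sub>v u"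
    using assms A row_mult_carrier[OF P, of u]
    by (simp add: row_mult_mult comm_add_vec[of "c \<cdot>\<^sub>v u" n])
  finally show ?thesis .
qed

lemma row_mult_poly_mat_carrier [simp]: "row_mult u (poly_mat f A) \<in> carrier_vec n"
  by (simp add: row_mult_carrier)

lemma row_mult_poly_mat_0: "u \<in> carrier_vec n \<Longrightarrow> row_mult u (poly_mat 0 A) = 0\<^sub>v n"
  by (intro eq_vecI) (auto simp: row_mult_def poly_mat_0)

lemma row_mult_poly_mat_1: "u \<in> carrier_vec n \<Longrightarrow> row_mult u (poly_mat 1 A) = u"
  by (intro eq_vecI) (auto simp: row_mult_def poly_mat_1)

lemma row_mult_char_poly: "u \<in> carrier_vec n \<Longrightarrow> row_mult u (poly_mat (char_poly A) A) = 0\<^sub>v n"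
  by (intro eq_vecI) (auto simp: row_mult_def cayley_hamilton)

end

subsection \<open>Results and operation bounds of counted programs\<close>

text \<open>The increment \<open>l\<close> and the value \<open>x\<close> are the same for every
  starting count \<open>t\<close>; this is what makes the bounds of consecutive programs add
  up.\<close>

definition computes_within :: "'b counted \<Rightarrow> 'b \<Rightarrow> nat \<Rightarrow> bool" where
  "computes_within c x k \<longleftrightarrow> (\<exists>l\<le>k. \<forall>t. run_state c t = (x, t + l))"

lemma computes_withinD:
  assumes "computes_within c x k"
  shows "result c = x" "operations c \<le> k"
  using assms by (auto simp: computes_within_def result_def operations_def)

lemma computes_within_mono:
  "computes_within c x k \<Longrightarrow> x = y \<Longrightarrow> k \<le> l \<Longrightarrow> computes_within c y l"
  by (auto simp: computes_within_def intro: order_trans)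

lemma computes_within_return: "computes_within (State_Monad.return x) x k"
  by (auto simp: computes_within_def)

lemma computes_within_bind:
  assumes "computes_within c x k" "computes_within (d x) y l"
  shows "computes_within (State_Monad.bind c d) y (k + l)"
proof -
  obtain k' l' where "k' \<le> k" "\<And>t. run_state c t = (x, t + k')"
    "l' \<le> l" "\<And>t. run_state (d x) t = (y, t + l')"
    using assms unfolding computes_within_def by blast
  then show ?thesis
    unfolding computes_within_def by (intro exI[of _ "k' + l'"]) (simp add: add.assoc)
qed

lemma computes_within_bind_return:
  assumes "computes_within c x k"
  shows "computes_within (State_Monad.bind c (\<lambda>x. State_Monad.return (g x))) (g x) k"
  using computes_within_bind[OF assms, of "\<lambda>x. State_Monad.return (g x)" "g x" 0]
  by (simp add: computes_within_return)

section \<open>Costs of the scalar and vector operations\<close>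

lemma computes_within_tick: "computes_within tick () 1"
  by (auto simp: computes_within_def tick_def)

lemma computes_within_add: "computes_within (add x y) (x + y) 1"
  unfolding add_def by (rule computes_within_bind_return[OF computes_within_tick])

lemma computes_within_mult: "computes_within (mult x y) (x * y) 1"
  unfolding mult_def by (rule computes_within_bind_return[OF computes_within_tick])

lemma computes_within_traverse_list:
  assumes "\<And>x. x \<in> set xs \<Longrightarrow> computes_within (g x) (h x) (b x)"
  shows "computes_within (traverse_list g xs) (map h xs) (\<Sum>x\<leftarrow>xs. b x)"
  using assms
proof (induction xs)
  case (Cons x xs)
  have "computes_within (traverse_list g (x # xs)) (h x # map h xs) (b x + (\<Sum>x\<leftarrow>xs. b x))"
    unfolding traverse_list.simps
    by (rule computes_within_bind[of _ "h x"], use Cons.prems in simp,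
        rule computes_within_bind_return, use Cons in simp)
  then show ?case by simp
qed (simp add: computes_within_return)

text \<open>Every pair costs one multiplication and one addition; the innermost addition, to the
  initial 0, is counted too.\<close>

lemma computes_within_dot:
  "computes_within (dot_counted ps) (\<Sum>(x, y)\<leftarrow>ps. x * y) (2 * length ps)"
proof (induction ps rule: dot_counted.induct)
  case (2 x y ps)
  have "computes_within (dot_counted ((x, y) # ps)) (x * y + (\<Sum>(x, y)\<leftarrow>ps. x * y))
      (2 * length ps + (1 + 1))"
    unfolding dot_counted.simps
    by (rule computes_within_bind[OF "2.IH"], rule computes_within_bind[OF computes_within_mult],
        rule computes_within_add)
  then show ?case by simp
qed (simp add: computes_within_return)

lemma sum_list_zip_scalar_prod:
  assumes "dim_vec v = dim_vec w"
  shows "(\<Sum>(x, y)\<leftarrow>zip (list_of_vec v) (list_of_vec w). x * y) = v \<bullet> w"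
proof -
  have "zip (list_of_vec v) (list_of_vec w) = map (\<lambda>i. (v $ i, w $ i)) [0..<dim_vec w]"
    using assms by (intro nth_equalityI) (auto simp: list_of_vec_index)
  then show ?thesis
    by (simp add: scalar_prod_def comp_def sum_list_distinct_conv_sum_set)
qed

lemma computes_within_row_mult:
  assumes "A \<in> carrier_mat n n" "w \<in> carrier_vec n"
  shows "computes_within (row_mult_counted w A) (row_mult w A) (2 * n ^ 2)"
proof -
  have "computes_within (row_mult_counted w A)
      (vec_of_list (map (\<lambda>j. w \<bullet> col A j) [0..<dim_col A])) (\<Sum>j\<leftarrow>[0..<dim_col A]. 2 * n)"
    unfolding row_mult_counted_def
  proof (intro computes_within_bind_return computes_within_traverse_list)
    fix j assume "j \<in> set [0..<dim_col A]"
    show "computes_within (dot_counted (zip (list_of_vec w) (list_of_vec (col A j)))) (w \<bullet> col A j) (2 * n)"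
      using assms by (intro computes_within_mono[OF computes_within_dot] sum_list_zip_scalar_prod) auto
  qed
  moreover have "vec_of_list (map (\<lambda>j. w \<bullet> col A j) [0..<dim_col A]) = row_mult w A"
    by (intro eq_vecI) (auto simp: row_mult_def vec_of_list_index)
  ultimately show ?thesis
    using assms by (simp add: sum_list_triv power2_eq_square ac_simps)
qed

lemma computes_within_smult:
  "computes_within (smult_counted c w) (c \<cdot>\<^sub>v w) (dim_vec w)"
proof -
  have "computes_within (smult_counted c w) (vec_of_list (map ((*) c) (list_of_vec w)))
      (\<Sum>x\<leftarrow>list_of_vec w. 1)"
    unfolding smult_counted_def
    by (intro computes_within_bind_return computes_within_traverse_list computes_within_mult)
  moreover have "vec_of_list (map ((*) c) (list_of_vec w)) = c \<cdot>\<^sub>v w"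
    by (intro eq_vecI) (auto simp: vec_of_list_index list_of_vec_index)
  ultimately show ?thesis by (simp add: sum_list_triv)
qed

lemma computes_within_add_vec:
  assumes "v \<in> carrier_vec n" "w \<in> carrier_vec n"
  shows "computes_within (add_counted v w) (v + w) n"
proof -
  let ?ps = "zip (list_of_vec v) (list_of_vec w)"
  have "computes_within (add_counted v w) (vec_of_list (map (\<lambda>(x, y). x + y) ?ps)) (\<Sum>p\<leftarrow>?ps. 1)"
    unfolding add_counted_def
    by (intro computes_within_bind_return computes_within_traverse_list)
      (auto simp: computes_within_add[simplified])
  moreover have "vec_of_list (map (\<lambda>(x, y). x + y) ?ps) = v + w"
    using assms by (intro eq_vecI) (auto simp: vec_of_list_index list_of_vec_index)
  ultimately show ?thesis using assms by (simp add: sum_list_triv)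
qed

section \<open>Costs of Horner's rule and of applying products of factors\<close>

context
  fixes A :: "'a::comm_ring_1 mat" and n :: nat
  assumes A: "A \<in> carrier_mat n n"
begin

text \<open>The leading coefficient costs one scaling, \<open>n\<close>; each further one costs a
  vector-matrix product, a scaling and a vector addition. For the empty list the truncated
  \<open>length cs - 1\<close> is 0.\<close>

lemma computes_within_horner_coeffs:
  assumes w: "w \<in> carrier_vec n"
  shows "computes_within (horner_coeffs A w cs) (row_mult w (poly_mat (Poly cs) A))
    (n + (length cs - 1) * (2 * n ^ 2 + 2 * n))"
proof (induction cs rule: induct_list012)
  case 1
  show ?case using A w by (simp add: row_mult_poly_mat_0 computes_within_return)
next
  case (2 c)
  have "row_mult w (poly_mat (Poly [c]) A) = c \<cdot>\<^sub>v w"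
    using A w by (simp add: row_mult_poly_mat_pCons row_mult_poly_mat_0)
      (intro eq_vecI; auto simp: row_mult_def)
  then show ?case using computes_within_smult[of c w] w by simp
next
  case (3 c c' cs)
  let ?b = "row_mult w (poly_mat (Poly (c' # cs)) A)"
  have b: "?b \<in> carrier_vec n" using A by (rule row_mult_poly_mat_carrier)
  have "computes_within (horner_coeffs A w (c # c' # cs)) (row_mult ?b A + c \<cdot>\<^sub>v w)
      ((n + (length (c' # cs) - 1) * (2 * n ^ 2 + 2 * n)) + (2 * n ^ 2 + (dim_vec w + n)))"
    unfolding horner_coeffs.simps
    using A w b
    by (intro computes_within_bind[OF "3.IH"(2)] computes_within_bind[OF computes_within_row_mult]
        computes_within_bind[OF computes_within_smult] computes_within_add_vec row_mult_carrier)
      auto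
  then show ?case
    using A w by (elim computes_within_mono) (simp_all add: row_mult_poly_mat_pCons)
qed

text \<open>With d the degree, the three terms n, 2nd and 2n^2 d are at most 1, 2 and 2 times n^2 d,
  since d is positive; hence the constant 5.\<close>

lemma computes_within_horner:
  assumes w: "w \<in> carrier_vec n" and f: "0 < degree f"
  shows "computes_within (horner A w f) (row_mult w (poly_mat f A)) (5 * n ^ 2 * degree f)"
proof -
  have "n \<le> n ^ 2" by (simp add: power2_eq_square)
  moreover from this have "n * degree f \<le> n ^ 2 * degree f" by simp
  moreover have "n ^ 2 \<le> n ^ 2 * degree f" using f by simp
  moreover have "n + degree f * (2 * n ^ 2 + 2 * n) = n + 2 * (n ^ 2 * degree f) + 2 * (n * degree f)"
    by (simp add: algebra_simps)
  ultimately have "n + degree f * (2 * n ^ 2 + 2 * n) \<le> 5 * n ^ 2 * degree f"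
    by linarith
  moreover have "f \<noteq> 0" using f by auto
  ultimately show ?thesis
    unfolding horner_def
    by (intro computes_within_mono[OF computes_within_horner_coeffs[OF w]])
      (auto simp: length_coeffs_degree)
qed

lemma computes_within_mult_power:
  assumes "v \<in> carrier_vec n" "0 < degree f"
  shows "computes_within (mult_power A f k v) (row_mult v (poly_mat (f ^ k) A))
    (5 * n ^ 2 * (k * degree f))"
  using assms(1)
proof (induction k arbitrary: v)
  case 0
  then show ?case using A by (simp add: row_mult_poly_mat_1 computes_within_return)
next
  case (Suc k)
  have "computes_within (mult_power A f (Suc k) v)
      (row_mult (row_mult v (poly_mat f A)) (poly_mat (f ^ k) A))
      (5 * n ^ 2 * degree f + 5 * n ^ 2 * (k * degree f))"
    unfolding mult_power.simps
    by (intro computes_within_bind[OF computes_within_horner[OF Suc.prems assms(2)]] Suc.IH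
        row_mult_poly_mat_carrier[OF A])
  then show ?case
    using A Suc.prems
    by (elim computes_within_mono) (simp_all add: row_mult_poly_mat_mult algebra_simps)
qed

lemma computes_within_mult_factors:
  assumes "v \<in> carrier_vec n" "\<And>p. p \<in> set ps \<Longrightarrow> 0 < degree (f p)"
  shows "computes_within (mult_factors A f m ps v)
    (row_mult v (poly_mat (\<Prod>p\<leftarrow>ps. f p ^ m p) A))
    (5 * n ^ 2 * (\<Sum>p\<leftarrow>ps. m p * degree (f p)))"
  using assms
proof (induction ps arbitrary: v)
  case Nil
  then show ?case using A by (simp add: row_mult_poly_mat_1 computes_within_return)
next
  case (Cons p ps)
  have "computes_within (mult_factors A f m (p # ps) v)
      (row_mult (row_mult v (poly_mat (f p ^ m p) A)) (poly_mat (\<Prod>p\<leftarrow>ps. f p ^ m p) A))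
      (5 * n ^ 2 * (m p * degree (f p)) + 5 * n ^ 2 * (\<Sum>p\<leftarrow>ps. m p * degree (f p)))"
    unfolding mult_factors.simps
    using Cons.prems
    by (intro computes_within_bind[OF computes_within_mult_power] Cons.IH
        row_mult_poly_mat_carrier[OF A]) auto
  then show ?case
    using A Cons.prems
    by (elim computes_within_mono) (simp_all add: row_mult_poly_mat_mult algebra_simps)
qed

text \<open>Each of the \<open>D\<close> levels below the root applies every factor \<open>f p ^ m p\<close> at most once,
  namely in passing to the child that does not contain \<open>p\<close>.\<close>

lemma computes_within_binary_splitting:
  assumes "v \<in> carrier_vec n" "a \<le> b" "b - a < 2 ^ D"
    and deg: "\<And>p. p \<in> {a..b} \<Longrightarrow> 0 < degree (f p)"
  shows "computes_within (binary_splitting A f m a b v)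
    (map (\<lambda>i. row_mult v (poly_mat (\<Prod>p\<in>{a..b} - {i}. f p ^ m p) A)) [a..<Suc b])
    (D * (5 * n ^ 2 * (\<Sum>p=a..b. m p * degree (f p))))"
  using assms
proof (induction D arbitrary: a b v)
  case 0
  then have "b = a" by simp
  then show ?case
    using A 0 by (subst binary_splitting.simps) (simp add: row_mult_poly_mat_1 computes_within_return)
next
  case (Suc D)
  show ?case
  proof (cases "b = a")
    case True
    then show ?thesis
      using A Suc.prems
      by (subst binary_splitting.simps) (simp add: row_mult_poly_mat_1 computes_within_return)
  next
    case False
    define h where "h = a + (b - a) div 2"
    \<comment> \<open>The left half has \<open>h - a\<close>, the floor of half of
      \<open>b - a\<close>, and the right half has \<open>b - Suc h\<close>, which is no larger.
      Bounding the difference of the ends instead of the number of leaves keeps both strictly below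
      \<open>2 ^ D\<close>.\<close>
    have h: "a \<le> h" "h < b" "h - a < 2 ^ D" "b - Suc h < 2 ^ D"
      using False Suc.prems(2,3) by (auto simp: h_def)
    define W where "W S = 5 * n ^ 2 * (\<Sum>p\<in>S. m p * degree (f p))" for S
    define P where "P S = (\<Prod>p\<in>S. f p ^ m p)" for S
    have split: "{a..b} = {a..h} \<union> {Suc h..b}" "{a..h} \<inter> {Suc h..b} = {}"
      using h by auto
    have W: "W {a..b} = W {a..h} + W {Suc h..b}"
      unfolding W_def split(1) by (subst sum.union_disjoint) (auto simp: algebra_simps)
    \<comment> \<open>The vector passed to the left child already carries all factors of the right
      half; a leaf \<open>i\<close> of the left subtree adds the remaining ones except its
      own.\<close>
    have PL: "P {Suc h..b} * P ({a..h} - {i}) = P ({a..b} - {i})" if "i \<le> h" for i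
    proof -
      have eq: "{a..b} - {i} = {Suc h..b} \<union> ({a..h} - {i})" using that h by auto
      show ?thesis unfolding P_def eq by (subst prod.union_disjoint) auto
    qed
    have PR: "P {a..h} * P ({Suc h..b} - {i}) = P ({a..b} - {i})" if "Suc h \<le> i" for i
    proof -
      have eq: "{a..b} - {i} = {a..h} \<union> ({Suc h..b} - {i})" using that h by auto
      show ?thesis unfolding P_def eq by (subst prod.union_disjoint) auto
    qed
    define vl where "vl = row_mult v (poly_mat (P {Suc h..b}) A)"
    define vr where "vr = row_mult v (poly_mat (P {a..h}) A)"
    have vlr: "vl \<in> carrier_vec n" "vr \<in> carrier_vec n"
      using A by (simp_all add: vl_def vr_def row_mult_poly_mat_carrier)
    have factors: "computes_within (mult_factors A f m [c..<Suc d] v)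
        (row_mult v (poly_mat (P {c..d}) A)) (W {c..d})" if "a \<le> c" "d \<le> b" for c d
    proof -
      have "computes_within (mult_factors A f m [c..<Suc d] v)
          (row_mult v (poly_mat (\<Prod>p\<leftarrow>[c..<Suc d]. f p ^ m p) A))
          (5 * n ^ 2 * (\<Sum>p\<leftarrow>[c..<Suc d]. m p * degree (f p)))"
        using that Suc.prems by (intro computes_within_mult_factors) auto
      moreover have "(\<Prod>p\<leftarrow>[c..<Suc d]. f p ^ m p) = P {c..d}"
        unfolding P_def by (subst prod.distinct_set_conv_list[symmetric])
          (simp_all only: distinct_upt set_upt atLeastLessThanSuc_atLeastAtMost)
      moreover have "5 * n ^ 2 * (\<Sum>p\<leftarrow>[c..<Suc d]. m p * degree (f p)) = W {c..d}"
        unfolding W_def by (subst sum.distinct_set_conv_list[symmetric])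
          (simp_all only: distinct_upt set_upt atLeastLessThanSuc_atLeastAtMost)
      ultimately show ?thesis by (simp only:)
    qed
    let ?ls = "map (\<lambda>i. row_mult vl (poly_mat (P ({a..h} - {i})) A)) [a..<Suc h]"
    let ?rs = "map (\<lambda>i. row_mult vr (poly_mat (P ({Suc h..b} - {i})) A)) [Suc h..<Suc b]"
    have L: "computes_within (binary_splitting A f m a h vl) ?ls (D * W {a..h})"
      unfolding P_def W_def using Suc.prems h vlr by (intro Suc.IH) auto
    have R: "computes_within (binary_splitting A f m (Suc h) b vr) ?rs (D * W {Suc h..b})"
      unfolding P_def W_def using Suc.prems h vlr by (intro Suc.IH) auto
    \<comment> \<open>The two children together pay \<open>W {a..b}\<close> once at this level, each
      applying the factors of its sibling; the subtrees pay \<open>D\<close> times their own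
      share.\<close>
    have "computes_within (binary_splitting A f m a b v) (?ls @ ?rs)
        (W {Suc h..b} + (W {a..h} + (D * W {a..h} + D * W {Suc h..b})))"
      using False Suc.prems(2) h
      by (subst binary_splitting.simps, simp only: Let_def h_def[symmetric] if_False not_le,
          simp del: upt_Suc,
          intro computes_within_bind[OF factors[of "Suc h" b, folded vl_def]]
            computes_within_bind[OF factors[of a h, folded vr_def]]
            computes_within_bind[OF L] computes_within_bind_return[OF R])
        auto
    moreover have "?ls @ ?rs = map (\<lambda>i. row_mult v (poly_mat (P ({a..b} - {i})) A)) [a..<Suc b]"
    proof -
      have "[a..<Suc b] = [a..<Suc h] @ [Suc h..<Suc b]"
        using h upt_add_eq_append[of a "Suc h" "b - h"] by simp
      moreover have "?ls = map (\<lambda>i. row_mult v (poly_mat (P ({a..b} - {i})) A)) [a..<Suc h]"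
        using A Suc.prems(1) by (auto simp: vl_def row_mult_poly_mat_mult PL simp del: upt_Suc)
      moreover have "?rs = map (\<lambda>i. row_mult v (poly_mat (P ({a..b} - {i})) A)) [Suc h..<Suc b]"
        using A Suc.prems(1) by (auto simp: vr_def row_mult_poly_mat_mult PR simp del: upt_Suc)
      ultimately show ?thesis by simp
    qed
    ultimately have "computes_within (binary_splitting A f m a b v)
        (map (\<lambda>i. row_mult v (poly_mat (P ({a..b} - {i})) A)) [a..<Suc b]) (Suc D * W {a..b})"
      by (elim computes_within_mono) (simp_all add: W algebra_simps)
    then show ?thesis unfolding P_def W_def .
  qed
qed

subsection \<open>Exponents\<close>

text \<open>The content of exponent slot \<open>j\<close> after the passes 0 to
  \<open>k - 1\<close>. The unbounded \<open>LEAST\<close> is safe because the guard places the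
  minimum below \<open>k\<close>.\<close>

definition first_zero :: "'a poly \<Rightarrow> 'a vec \<Rightarrow> nat \<Rightarrow> nat \<Rightarrow> nat option" where
  "first_zero f b k j =
    (if \<exists>l<k. row_mult b (poly_mat (f ^ l) A) $ j = 0
     then Some (LEAST l. row_mult b (poly_mat (f ^ l) A) $ j = 0) else None)"

text \<open>Has exactly the form of the update in \<open>set_exponents\<close>, so one pass of the
  loop turns \<open>first_zero f b k\<close> into \<open>first_zero f b (Suc k)\<close>.\<close>

lemma first_zero_Suc:
  "first_zero f b (Suc k) j =
    (if first_zero f b k j = None \<and> row_mult b (poly_mat (f ^ k) A) $ j = 0
     then Some k else first_zero f b k j)"
proof (cases "(\<forall>l<k. row_mult b (poly_mat (f ^ l) A) $ j \<noteq> 0) \<and> row_mult b (poly_mat (f ^ k) A) $ j = 0")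
  case True
  then have "(LEAST l. row_mult b (poly_mat (f ^ l) A) $ j = 0) = k"
    by (intro Least_equality) (auto simp: not_less[symmetric])
  with True show ?thesis by (auto simp: first_zero_def)
qed (auto simp: first_zero_def less_Suc_eq)

text \<open>An exponent never changes once set; this justifies leaving the loop early.\<close>

lemma first_zero_mono:
  "k \<le> l \<Longrightarrow> first_zero f b k j \<noteq> None \<Longrightarrow> first_zero f b l j = first_zero f b k j"
  by (force simp: first_zero_def split: if_splits)

text \<open>The loop invariant: at counter \<open>k\<close> the vector is b f(A)^k and the table is
  \<open>first_zero f b k\<close>. The induction runs from \<open>m\<close> downwards, because the
  loop consumes \<open>[k..<m]\<close> from the front.\<close>

lemma computes_within_exponent_loop:
  assumes "b \<in> carrier_vec n" "0 < degree f" "k \<le> m"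
  shows "computes_within
    (exponent_loop A f [k..<m] (row_mult b (poly_mat (f ^ k) A)) (map (first_zero f b k) [0..<n]))
    (map (first_zero f b m) [0..<n]) (5 * n ^ 2 * ((m - k) * degree f))"
  using assms(3)
proof (induction rule: inc_induct)
  case base
  show ?case by (simp add: computes_within_return)
next
  case (step k)
  let ?b = "row_mult b (poly_mat (f ^ k) A)" and ?r = "map (first_zero f b k) [0..<n]"
  have b: "?b \<in> carrier_vec n" using A by (rule row_mult_poly_mat_carrier)
  have upt: "[k..<m] = k # [Suc k..<m]" using step.hyps by (simp add: upt_conv_Cons)
  show ?case
  \<comment> \<open>On early exit all exponents are set, so the table already agrees with the one
    after \<open>m\<close> passes.\<close>
  proof (cases "?b = 0\<^sub>v (dim_vec ?b) \<and> None \<notin> set ?r")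
    case True
    have eq: "map (first_zero f b m) [0..<n] = ?r"
    proof (rule map_cong[OF refl])
      fix j assume "j \<in> set [0..<n]"
      then have "first_zero f b k j \<noteq> None" using True by force
      then show "first_zero f b m j = first_zero f b k j"
        using step.hyps by (intro first_zero_mono) auto
    qed
    then show ?thesis
      unfolding upt exponent_loop.simps if_P[OF True] eq by (simp add: computes_within_return)
  next
    case False
    have set: "set_exponents k ?b ?r = map (first_zero f b (Suc k)) [0..<n]"
      using b by (intro nth_equalityI) (auto simp: set_exponents_def first_zero_Suc list_of_vec_index)
    have "row_mult ?b (poly_mat f A) = row_mult b (poly_mat (f ^ Suc k) A)"
      using A assms by (simp add: row_mult_poly_mat_mult mult.commute)
    with computes_within_horner[OF b assms(2)]
    have "computes_within (horner A ?b f) (row_mult b (poly_mat (f ^ Suc k) A)) (5 * n ^ 2 * degree f)"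
      by simp
    then have "computes_within (exponent_loop A f [k..<m] ?b ?r) (map (first_zero f b m) [0..<n])
        (5 * n ^ 2 * degree f + 5 * n ^ 2 * ((m - Suc k) * degree f))"
      unfolding upt exponent_loop.simps if_not_P[OF False] Let_def set
      by (rule computes_within_bind) (rule step.IH)
    moreover have "m - k = Suc (m - Suc k)" using step.hyps by simp
    ultimately show ?thesis by (simp add: algebra_simps)
  qed
qed

lemma computes_within_exponents:
  assumes b: "b \<in> carrier_vec n" and "0 < degree f"
    and zero: "row_mult b (poly_mat (f ^ m) A) = 0\<^sub>v n"
  shows "computes_within (exponents A f m b)
    (map (\<lambda>j. LEAST k. row_mult b (poly_mat (f ^ k) A) $ j = 0) [0..<n])
    (5 * n ^ 2 * (m * degree f))"
proof -
  have start: "replicate (dim_vec b) None = map (first_zero f b 0) [0..<n]"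
    using b by (intro nth_equalityI) (auto simp: first_zero_def)
  have "computes_within (exponent_loop A f [0..<m] b (replicate (dim_vec b) None))
      (map (first_zero f b m) [0..<n]) (5 * n ^ 2 * (m * degree f))"
    using computes_within_exponent_loop[OF assms(1,2), of 0 m]
    unfolding start power_0 row_mult_poly_mat_1[OF A b] by simp
  then have "computes_within (exponents A f m b)
      (map (\<lambda>e. case e of None \<Rightarrow> m | Some k \<Rightarrow> k) (map (first_zero f b m) [0..<n]))
      (5 * n ^ 2 * (m * degree f))"
    unfolding exponents_def by (rule computes_within_bind_return)
  moreover have "(case first_zero f b m j of None \<Rightarrow> m | Some k \<Rightarrow> k) =
      (LEAST k. row_mult b (poly_mat (f ^ k) A) $ j = 0)" if "j < n" for j
  proof (cases "\<exists>l<m. row_mult b (poly_mat (f ^ l) A) $ j = 0")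
    \<comment> \<open>The loop found no zero below \<open>m\<close>, and \<open>zero\<close>
      provides one at \<open>m\<close> itself: the default value is the minimum.\<close>
    case False
    then have "(LEAST k. row_mult b (poly_mat (f ^ k) A) $ j = 0) = m"
      using zero that by (intro Least_equality) (auto simp: not_less[symmetric])
    with False show ?thesis by (simp add: first_zero_def)
  qed (simp add: first_zero_def)
  ultimately show ?thesis
    by (elim computes_within_mono) auto
qed

end

subsection \<open>The algorithm\<close>

text \<open>Over a field the polynomials of degree 0 are zero or units, hence not irreducible. This
  supplies the positive degree required by the Horner bound.\<close>

lemma irreducible_factorization_degree:
  assumes "irreducible_factorization h q f m" "p \<in> {1..q}"
  shows "0 < degree (f p)"
proof -
  have "irreducible (f p)"
    using assms by (simp add: irreducible_factorization_def)
  then show ?thesis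
    by (metis bot_nat_0.not_eq_extremum irreducible_def is_unit_iff_degree)
qed

text \<open>For the characteristic polynomial the left side is \<open>n\<close>; this turns sums of
  Horner costs into powers of \<open>n\<close>.\<close>

lemma degree_irreducible_factorization:
  assumes "irreducible_factorization h q f m"
  shows "degree h = (\<Sum>p=1..q. m p * degree (f p))"
proof -
  have "f p \<noteq> 0" if "p \<in> {1..q}" for p
    using irreducible_factorization_degree[OF assms that] by auto
  then show ?thesis
    using assms
    by (simp add: irreducible_factorization_def degree_prod_eq_sum_degree degree_power_eq mult.commute)
qed

text \<open>The division is exact. The product form is what binary splitting delivers at leaf
  \<open>i\<close>; the second equation leads to Cayley-Hamilton.\<close>

lemma cofactor_poly_eq_prod:
  assumes "irreducible_factorization (char_poly A) q f m" "i \<in> {1..q}"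
  shows "cofactor_poly A f m i = (\<Prod>p\<in>{1..q} - {i}. f p ^ m p)"
    and "cofactor_poly A f m i * f i ^ m i = char_poly A"
proof -
  have "f i ^ m i \<noteq> 0"
    using irreducible_factorization_degree[OF assms] by auto
  moreover have "char_poly A = f i ^ m i * (\<Prod>p\<in>{1..q} - {i}. f p ^ m p)"
    using assms by (simp add: irreducible_factorization_def prod.remove)
  ultimately show "cofactor_poly A f m i = (\<Prod>p\<in>{1..q} - {i}. f p ^ m p)"
    and "cofactor_poly A f m i * f i ^ m i = char_poly A"
    by (simp_all add: cofactor_poly_def)
qed

text \<open>Trades the matrix power for a polynomial power, matching the loop invariant.\<close>

lemma w_entry_eq:
  assumes "A \<in> carrier_mat n n"
  shows "w_entry A f m u i j k =
    row_mult (row_mult u (poly_mat (cofactor_poly A f m i) A)) (poly_mat (f i ^ k) A) $ j"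
  using assms by (simp add: w_entry_def poly_mat_power)

lemma computes_within_algorithm_P:
  fixes A :: "'a::field mat"
  assumes A: "A \<in> carrier_mat n n" and fact: "irreducible_factorization (char_poly A) q f m"
    and u: "u \<in> carrier_vec n" and D: "q \<le> 2 ^ D"
  shows "computes_within (algorithm_P A q f m u)
    (map (\<lambda>i. map (\<lambda>j. pa_exponent A f m u i j) [0..<n]) [1..<Suc q]) (5 * n ^ 3 * (D + 1))"
\<comment> \<open>Without factors the call with bounds 1 and 0 stops at once, at no cost, and no
  exponent loop is run.\<close>
proof (cases "q = 0")
  case True
  show ?thesis
    unfolding algorithm_P_def
    by (subst binary_splitting.simps) (simp add: True computes_within_return)
next
  case False
  have deg: "0 < degree (f p)" if "p \<in> {1..q}" for p
    using irreducible_factorization_degree[OF fact that] .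
  have n: "n = (\<Sum>p=1..q. m p * degree (f p))"
    using degree_irreducible_factorization[OF fact] degree_monic_char_poly[OF A] by simp
  let ?b = "\<lambda>i. row_mult u (poly_mat (cofactor_poly A f m i) A)"
  let ?bs = "map ?b [1..<Suc q]"
  have bs: "?bs = map (\<lambda>i. row_mult u (poly_mat (\<Prod>p\<in>{1..q} - {i}. f p ^ m p) A)) [1..<Suc q]"
    by (intro map_cong refl) (subst cofactor_poly_eq_prod(1)[OF fact], auto simp del: upt_Suc)
  have split: "computes_within (binary_splitting A f m 1 q u) ?bs (D * (5 * n ^ 2 * n))"
    unfolding bs
    by (rule computes_within_binary_splitting[OF A u, of 1 q D f m, folded n])
      (use D False deg in auto)
  have "computes_within (exponents A (f i) (m i) (?bs ! (i - 1)))
      (map (\<lambda>j. pa_exponent A f m u i j) [0..<n]) (5 * n ^ 2 * (m i * degree (f i)))"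
    if "i \<in> set [1..<Suc q]" for i
  proof -
    have i: "i \<in> {1..q}" using that by auto
    have "?bs ! (i - 1) = ?b i" using i by (subst nth_map) (auto simp del: upt_Suc)
    \<comment> \<open>This is u \<chi>(A) = 0, with \<chi> the characteristic polynomial: g_i times
      the full power of f_i restores \<chi>.\<close>
    moreover have "row_mult (?b i) (poly_mat (f i ^ m i) A) = 0\<^sub>v n"
      using A u by (simp add: row_mult_poly_mat_mult cofactor_poly_eq_prod(2)[OF fact i] row_mult_char_poly)
    ultimately show ?thesis
      using computes_within_exponents[OF A row_mult_poly_mat_carrier[OF A] deg[OF i]]
      by (simp add: pa_exponent_def w_entry_eq[OF A])
  qed
  then have "computes_within
      (traverse_list (\<lambda>i. exponents A (f i) (m i) (?bs ! (i - 1))) [1..<Suc q])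
      (map (\<lambda>i. map (\<lambda>j. pa_exponent A f m u i j) [0..<n]) [1..<Suc q])
      (\<Sum>i\<leftarrow>[1..<Suc q]. 5 * n ^ 2 * (m i * degree (f i)))"
    by (rule computes_within_traverse_list)
  moreover have "(\<Sum>i\<leftarrow>[1..<Suc q]. 5 * n ^ 2 * (m i * degree (f i))) = 5 * n ^ 2 * n"
  proof -
    have "set [1..<Suc q] = {1..q}" by auto
    then have "(\<Sum>i\<leftarrow>[1..<Suc q]. 5 * n ^ 2 * (m i * degree (f i))) =
        5 * n ^ 2 * (\<Sum>p=1..q. m p * degree (f p))"
      by (simp del: upt_Suc add: sum_list_distinct_conv_sum_set sum_distrib_left)
    then show ?thesis using n by simp
  qed
  ultimately have "computes_within
      (traverse_list (\<lambda>i. exponents A (f i) (m i) (?bs ! (i - 1))) [1..<Suc q])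
      (map (\<lambda>i. map (\<lambda>j. pa_exponent A f m u i j) [0..<n]) [1..<Suc q]) (5 * n ^ 2 * n)"
    by (simp only:)
  then have "computes_within (algorithm_P A q f m u)
      (map (\<lambda>i. map (\<lambda>j. pa_exponent A f m u i j) [0..<n]) [1..<Suc q])
      (D * (5 * n ^ 2 * n) + 5 * n ^ 2 * n)"
    unfolding algorithm_P_def by (rule computes_within_bind[OF split])
  then show ?thesis
    by (elim computes_within_mono) (simp_all add: algebra_simps power2_eq_square power3_eq_cube)
qed

text \<open>For positive \<open>q\<close> take the logarithm rounded up: then D + 1 is at most log q
  + 2, hence at most three times the maximum. For \<open>q = 0\<close> take D = 0.\<close>

lemma ex_power_of_two_ge:
  "\<exists>D. q \<le> 2 ^ D \<and> real D + 1 \<le> 3 * max 1 (log 2 (real q))"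
proof (cases "q = 0")
  case False
  then have log_nonneg: "0 \<le> log 2 (real q)" by simp
  define D where "D = nat \<lceil>log 2 (real q)\<rceil>"
  have D: "log 2 (real q) \<le> real D" "real D \<le> log 2 (real q) + 1"
    using log_nonneg unfolding D_def by linarith+
  have "real q = 2 powr log 2 (real q)" using False by simp
  also have "\<dots> \<le> 2 powr real D" using D(1) by simp
  also have "\<dots> = real (2 ^ D)" by (simp add: powr_realpow)
  finally have "q \<le> 2 ^ D" by linarith
  with D show ?thesis by (intro exI[of _ D]) auto
qed (auto intro!: exI[of _ 0])

text \<open>\<open>C\<close> is chosen before all other data, so one constant serves all sizes and
  inputs. As \<open>u\<close> is arbitrary, the bound holds for every outcome of the random choice,
  and correctness for every nonzero one.\<close>

theorem proposition8:
  shows "\<exists>C::real. \<forall>(n::nat) (A::'a::field_char_0 mat) (q::nat) (f::nat \<Rightarrow> 'a poly) (m::nat \<Rightarrow> nat) (u::'a vec).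
    A \<in> carrier_mat n n \<longrightarrow> irreducible_factorization (char_poly A) q f m \<longrightarrow> u \<in> carrier_vec n \<longrightarrow>
      (u \<noteq> 0\<^sub>v n \<longrightarrow>
        result (algorithm_P A q f m u)
          = map (\<lambda>i. map (\<lambda>j. pa_exponent A f m u i j) [0..<n]) [1..<Suc q] \<and>
        (\<forall>j<n. (\<Prod>i=1..q. f i ^ (result (algorithm_P A q f m u) ! (i - 1) ! j))
          = unit_pseudo_annihilating_poly A q f m u j)) \<and>
      real (operations (algorithm_P A q f m u)) \<le> C * (real n ^ 3 * max 1 (log 2 (real q)))"
proof (intro exI[of _ 15] allI impI conjI)
  fix n q :: nat and A :: "'a mat" and f :: "nat \<Rightarrow> 'a poly" and m :: "nat \<Rightarrow> nat" and u :: "'a vec"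
  assume A: "A \<in> carrier_mat n n" and fact: "irreducible_factorization (char_poly A) q f m"
    and u: "u \<in> carrier_vec n"
  obtain D where D: "q \<le> 2 ^ D" "real D + 1 \<le> 3 * max 1 (log 2 (real q))"
    using ex_power_of_two_ge by blast
  note run = computes_withinD[OF computes_within_algorithm_P[OF A fact u D(1)]]
  show "result (algorithm_P A q f m u)
      = map (\<lambda>i. map (\<lambda>j. pa_exponent A f m u i j) [0..<n]) [1..<Suc q]"
    by (rule run(1))
  show "(\<Prod>i=1..q. f i ^ (result (algorithm_P A q f m u) ! (i - 1) ! j))
      = unit_pseudo_annihilating_poly A q f m u j" if "j < n" for j
    unfolding unit_pseudo_annihilating_poly_def run(1)
    using that by (intro prod.cong refl) (auto simp del: upt_Suc)
  have "real (operations (algorithm_P A q f m u)) \<le> real (5 * n ^ 3 * (D + 1))"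
    using run(2) by (rule of_nat_mono)
  also have "\<dots> = 5 * real n ^ 3 * (real D + 1)" by (simp add: algebra_simps)
  \<comment> \<open>The constant 15 is 5 from Horner's rule times 3 from replacing the depth by the
    logarithm.\<close>
  also have "\<dots> \<le> 5 * real n ^ 3 * (3 * max 1 (log 2 (real q)))"
    using D(2) by (intro mult_left_mono) auto
  finally show "real (operations (algorithm_P A q f m u))
      \<le> 15 * (real n ^ 3 * max 1 (log 2 (real q)))"
    by simp
qed

end
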